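(* As $m \to + \infty$, $$\frac{16}{3 \sqrt 3} m^3 \lesssim \mathsf{D} (\mathcal{B}^{(3)}_m) \lesssim \frac{1372}{81}\, \pi\, m^3.$$
   Context: For positive sequences, $u_m\lesssim v_m$ means $\liminf_{m\to+\infty} v_m/u_m\ge 1$. A minimal zero-sum sequence over a subset $X$ of an abelian group is a finite unordered sequence (multiset) of elements of $X$ summing to $0$ with no non-empty proper subsequence summing to $0$; $\mathsf{D}(X)$ is the largest length of such a sequence. $\mathcal{B}^{(3)}_m=\{(u_1,u_2,u_3)\in\mathbb{Z}^3 : u_1^2+u_2^2+u_3^2\le m^2\}$. *)

theory Defs
  imports Complex_Main "HOL-Library.Multiset" "HOL-Library.Product_Plus"
    "HOL-Library.Extended_Real"
begin

(* The sequences are extended-real valued so that a Davenport constant can be used without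
   first proving it finite.  As c / \<infinity> = 0 for real c, an upper bound by a real sequence
   forces the bounded sequence to be eventually finite. *)
definition asymp_le :: "(nat \<Rightarrow> ereal) \<Rightarrow> (nat \<Rightarrow> ereal) \<Rightarrow> bool" where
  "asymp_le u v \<longleftrightarrow> liminf (\<lambda>m. v m / u m) \<ge> 1"

definition minimal_zero_sum :: "'a::ab_group_add set \<Rightarrow> 'a multiset \<Rightarrow> bool" where
  "minimal_zero_sum X S \<longleftrightarrow>
     set_mset S \<subseteq> X \<and> \<Sum>\<^sub># S = 0 \<and> (\<forall>T. T \<subset># S \<longrightarrow> T \<noteq> {#} \<longrightarrow> \<Sum>\<^sub># T \<noteq> 0)"

(* The empty sequence satisfies minimal_zero_sum, so the supremum is over a nonempty set;
   it is the maximum when the lengths are bounded and \<infinity> otherwise. *)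
definition davenport :: "'a::ab_group_add set \<Rightarrow> enat" where
  "davenport X = (SUP S \<in> {S. minimal_zero_sum X S}. enat (size S))"

definition ball3 :: "nat \<Rightarrow> (int \<times> int \<times> int) set" where
  "ball3 m = {(u1, u2, u3). u1\<^sup>2 + u2\<^sup>2 + u3\<^sup>2 \<le> (int m)\<^sup>2}"

end

theory Submission
  imports Defs "HOL-Analysis.Analysis" "HOL-Real_Asymp.Real_Asymp"
begin

text \<open>Upper bound: the Steinitz rearrangement lemma with Banaszczyk's constant
  d - 1 + 1/d orders a zero-sum sequence in a ball of radius m of R^3 so that all its prefix sums
  lie in the ball of radius 7m/3.  If the sequence is a minimal zero-sum sequence, the proper
  prefix sums are distinct lattice points, and these are counted by volume.

  Lower bound: 4 lattice vectors close to the vertices of a regular tetrahedron inscribed in the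
  sphere of radius m satisfy a single linear relation up to scaling.  If its positive integer
  coefficients are coprime, they are the multiplicities of a minimal zero-sum sequence.  By
  Cramer's rule they are 3 by 3 minors, and their sum is asymptotically 6 times the volume of the
  tetrahedron.\<close>

subsection \<open>The Steinitz lemma with Banaszczyk's constant\<close>

text \<open>The family is indexed because sequences may repeat vectors: a repetition gives the
  relation with coefficients 1 and -1, and otherwise the image is a dependent set.\<close>

lemma linear_relation_of_card_gt_DIM:
  fixes w :: "'i \<Rightarrow> 'b::euclidean_space"
  assumes fin: "finite F" and card: "card F > DIM('b)"
  shows "\<exists>c. (\<exists>i\<in>F. c i \<noteq> 0) \<and> (\<Sum>i\<in>F. c i *\<^sub>R w i) = 0"
proof (cases "inj_on w F")
  case True
  have "dependent (w ` F)"
    using card True by (intro dependent_biggerset) (auto simp: card_image fin)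
  then obtain u where u: "\<exists>x\<in>w ` F. u x \<noteq> 0" "(\<Sum>x\<in>w ` F. u x *\<^sub>R x) = 0"
    using dependent_finite[of "w ` F"] fin by auto
  then show ?thesis
    using True by (intro exI[of _ "u \<circ> w"]) (auto simp: sum.reindex)
next
  case False
  then obtain i j where ij: "i \<in> F" "j \<in> F" "i \<noteq> j" "w i = w j"
    by (auto simp: inj_on_def)
  let ?c = "\<lambda>k. if k = i then 1 else if k = j then -1 else (0::real)"
  have "(\<Sum>k\<in>F. ?c k *\<^sub>R w k) = (\<Sum>k\<in>{i, j}. ?c k *\<^sub>R w k)"
    using ij fin by (intro sum.mono_neutral_right) auto
  also have "\<dots> = 0" using ij by simp
  finally show ?thesis using ij by (intro exI[of _ ?c]) auto
qed

text \<open>The vertex argument of linear programming: while more than \<open>DIM('b)\<close>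
  weights are fractional, a linear relation among their vectors gives a direction in which to shift
  the weights until one of them becomes 0 or 1.\<close>

lemma reduce_fractional_weights:
  fixes w :: "'i \<Rightarrow> 'b::euclidean_space"
  assumes fin: "finite V" and "Y \<subseteq> V" and "\<forall>i\<in>V. 0 \<le> l i \<and> l i \<le> 1"
  shows "\<exists>l'. (\<forall>i\<in>V. 0 \<le> l' i \<and> l' i \<le> 1) \<and>
           (\<Sum>i\<in>V. l' i *\<^sub>R w i) = (\<Sum>i\<in>V. l i *\<^sub>R w i) \<and> sum l' Y \<le> sum l Y \<and>
           card {i\<in>V. 0 < l' i \<and> l' i < 1} \<le> DIM('b)"
  using assms(3)
proof (induction "card {i\<in>V. 0 < l i \<and> l i < 1}" arbitrary: l rule: less_induct)
  case less
  define F where "F = {i\<in>V. 0 < l i \<and> l i < 1}"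
  have finF: "finite F" and FV: "F \<subseteq> V" using fin by (auto simp: F_def)
  show ?case
  proof (cases "card F \<le> DIM('b)")
    case True
    then show ?thesis using less.prems by (intro exI[of _ l]) (auto simp: F_def)
  next
    case False
    then obtain c0 where c0: "\<exists>i\<in>F. c0 i \<noteq> 0" "(\<Sum>i\<in>F. c0 i *\<^sub>R w i) = 0"
      using linear_relation_of_card_gt_DIM[OF finF, of w] by force
    \<comment> \<open>With this sign, shifting the weights along \<open>c\<close> does not increase
      the weight of \<open>Y\<close>.\<close>
    define c where "c = (if sum c0 (F \<inter> Y) \<le> 0 then c0 else (\<lambda>i. - c0 i))"
    have c: "\<exists>i\<in>F. c i \<noteq> 0" "(\<Sum>i\<in>F. c i *\<^sub>R w i) = 0" "sum c (F \<inter> Y) \<le> 0"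
      using c0 by (auto simp: c_def sum_negf)
    \<comment> \<open>\<open>r i\<close> is how far the weights can move along \<open>c\<close>
      before weight \<open>i\<close> reaches 1 or 0. The least such distance keeps all weights in
      [0, 1] and makes one of them 0 or 1.\<close>
    define r where "r = (\<lambda>i. if c i > 0 then (1 - l i) / c i else l i / (- c i))"
    define F0 where "F0 = {i\<in>F. c i \<noteq> 0}"
    have F0: "finite F0" "F0 \<noteq> {}" "F0 \<subseteq> F" using c(1) finF by (auto simp: F0_def)
    define t where "t = Min (r ` F0)"
    have "t \<in> r ` F0" unfolding t_def using F0 by (intro Min_in) auto
    then obtain j where j: "j \<in> F0" "t = r j" by auto
    have rpos: "r i > 0" if "i \<in> F0" for i
      using that by (auto simp: r_def F0_def F_def divide_pos_neg)
    have tpos: "t > 0" using rpos j by auto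
    have tle: "t \<le> r i" if "i \<in> F0" for i unfolding t_def using that F0 by auto
    define l1 where "l1 = (\<lambda>i. if i \<in> F then l i + t * c i else l i)"
    have l1_bounds: "0 \<le> l1 i \<and> l1 i \<le> 1" if i: "i \<in> V" for i
    proof (cases "i \<in> F0")
      case True
      then have iF: "i \<in> F" "0 < l i" "l i < 1" and cn: "c i \<noteq> 0" by (auto simp: F0_def F_def)
      show ?thesis
      proof (cases "c i > 0")
        case True
        have "t \<le> (1 - l i) / c i" using tle[OF \<open>i \<in> F0\<close>] True by (simp add: r_def)
        then have "t * c i \<le> 1 - l i" using True by (simp add: pos_le_divide_eq)
        moreover have "t * c i > 0" using True tpos by simp
        ultimately show ?thesis using iF by (simp add: l1_def)
      next
        case False
        then have neg: "c i < 0" using cn by simp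
        have "t \<le> l i / (- c i)" using tle[OF \<open>i \<in> F0\<close>] False by (simp add: r_def)
        then have "t * (- c i) \<le> l i" using neg by (subst (asm) pos_le_divide_eq) auto
        moreover have "t * (- c i) > 0" using neg tpos by (intro mult_pos_pos) auto
        ultimately show ?thesis using iF by (simp add: l1_def)
      qed
    next
      case False
      then have "l1 i = l i" by (auto simp: l1_def F0_def)
      then show ?thesis using less.prems i by simp
    qed
    have jhit: "l1 j = 0 \<or> l1 j = 1" using j by (auto simp: l1_def r_def F0_def)
    have "{i\<in>V. 0 < l1 i \<and> l1 i < 1} \<subseteq> F" by (auto simp: l1_def F_def)
    moreover have "j \<notin> {i\<in>V. 0 < l1 i \<and> l1 i < 1}" "j \<in> F" using jhit j F0 by auto
    ultimately have "{i\<in>V. 0 < l1 i \<and> l1 i < 1} \<subset> F" by blast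
    then have "card {i\<in>V. 0 < l1 i \<and> l1 i < 1} < card F" using finF by (intro psubset_card_mono)
    then obtain l' where l': "\<forall>i\<in>V. 0 \<le> l' i \<and> l' i \<le> 1"
        "(\<Sum>i\<in>V. l' i *\<^sub>R w i) = (\<Sum>i\<in>V. l1 i *\<^sub>R w i)" "sum l' Y \<le> sum l1 Y"
        "card {i\<in>V. 0 < l' i \<and> l' i < 1} \<le> DIM('b)"
      using less.hyps[of l1] l1_bounds unfolding F_def by blast
    have l1_eq: "l1 i = l i + t * (if i \<in> F then c i else 0)" for i by (simp add: l1_def)
    have "(\<Sum>i\<in>V. l1 i *\<^sub>R w i)
        = (\<Sum>i\<in>V. l i *\<^sub>R w i) + t *\<^sub>R (\<Sum>i\<in>V. (if i \<in> F then c i else 0) *\<^sub>R w i)"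
      by (simp add: l1_eq scaleR_add_left sum.distrib scaleR_sum_right)
    also have "(\<Sum>i\<in>V. (if i \<in> F then c i else 0) *\<^sub>R w i) = (\<Sum>i\<in>F. c i *\<^sub>R w i)"
      using fin FV by (intro sum.mono_neutral_cong_right) auto
    finally have "(\<Sum>i\<in>V. l1 i *\<^sub>R w i) = (\<Sum>i\<in>V. l i *\<^sub>R w i)" using c by simp
    moreover have "sum l1 Y \<le> sum l Y"
    proof -
      have "finite Y" using assms finite_subset by blast
      have "(\<Sum>i\<in>Y. if i \<in> F then c i else 0) = sum c (F \<inter> Y)"
        using \<open>finite Y\<close> by (simp add: sum.If_cases Int_commute)
      then have "sum l1 Y = sum l Y + t * sum c (F \<inter> Y)"
        by (simp add: l1_eq sum.distrib flip: sum_distrib_left)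
      then show ?thesis using c(3) tpos by (simp add: mult_nonneg_nonpos)
    qed
    ultimately show ?thesis using l' by (intro exI[of _ l']) auto
  qed
qed

definition weighted_relation :: "('i \<Rightarrow> 'a::real_vector) \<Rightarrow> 'i set \<Rightarrow> ('i \<Rightarrow> real) \<Rightarrow> bool" where
  "weighted_relation v V l \<longleftrightarrow> (\<forall>i\<in>V. 0 \<le> l i \<and> l i \<le> 1) \<and> (\<Sum>i\<in>V. l i *\<^sub>R v i) = 0"

lemma weighted_relation_subset:
  assumes "weighted_relation v V l" "V' \<subseteq> V" "finite V" "\<forall>i\<in>V - V'. l i = 0"
  shows "weighted_relation v V' l" and "sum l V' = sum l V"
proof -
  have "(\<Sum>i\<in>V'. l i *\<^sub>R v i) = (\<Sum>i\<in>V. l i *\<^sub>R v i)"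
    using assms by (intro sum.mono_neutral_left) auto
  then show "weighted_relation v V' l" using assms by (auto simp: weighted_relation_def)
  show "sum l V' = sum l V" using assms by (intro sum.mono_neutral_left) auto
qed

text \<open>Scaling by \<open>T / sum l V\<close>, which is at most 1, gives total weight
  \<open>T\<close>. Appending a coordinate 1 to every vector then preserves this total during the
  reduction, at the cost of one dimension.\<close>

lemma weighted_relation_few_fractional:
  fixes v :: "'i \<Rightarrow> 'a::euclidean_space"
  assumes "weighted_relation v V l" "finite V" "Y \<subseteq> V" "0 < T" "T \<le> sum l V"
  shows "\<exists>l'. weighted_relation v V l' \<and> sum l' V = T \<and> sum l' Y \<le> sum l Y \<and>
           card {i\<in>V. 0 < l' i \<and> l' i < 1} \<le> DIM('a) + 1"
proof -
  define s where "s = T / sum l V"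
  have s: "0 < s" "s \<le> 1" using assms by (auto simp: s_def)
  have lb: "\<forall>i\<in>V. 0 \<le> l i \<and> l i \<le> 1" using assms by (auto simp: weighted_relation_def)
  have "\<forall>i\<in>V. 0 \<le> s * l i \<and> s * l i \<le> 1" using lb s by (auto intro: mult_le_one)
  from reduce_fractional_weights[OF assms(2,3) this, of "\<lambda>i. (v i, 1 :: real)"]
  obtain l' where l': "\<forall>i\<in>V. 0 \<le> l' i \<and> l' i \<le> 1"
      "(\<Sum>i\<in>V. l' i *\<^sub>R (v i, 1::real)) = (\<Sum>i\<in>V. (s * l i) *\<^sub>R (v i, 1::real))"
      "sum l' Y \<le> (\<Sum>i\<in>Y. s * l i)" "card {i\<in>V. 0 < l' i \<and> l' i < 1} \<le> DIM('a \<times> real)"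
    by blast
  have "(\<Sum>i\<in>V. l' i *\<^sub>R v i) = (\<Sum>i\<in>V. (s * l i) *\<^sub>R v i)"
    using arg_cong[OF l'(2), of fst] by (simp add: fst_sum)
  also have "\<dots> = s *\<^sub>R (\<Sum>i\<in>V. l i *\<^sub>R v i)" by (simp add: scaleR_sum_right)
  also have "\<dots> = 0" using assms by (simp add: weighted_relation_def)
  finally have 1: "weighted_relation v V l'" using l'(1) by (simp add: weighted_relation_def)
  have "sum l' V = s * sum l V"
    using arg_cong[OF l'(2), of snd] by (simp add: snd_sum sum_distrib_left)
  then have 2: "sum l' V = T" using assms by (simp add: s_def)
  have "(\<Sum>i\<in>Y. s * l i) = s * sum l Y" by (simp add: sum_distrib_left)
  also have "\<dots> \<le> sum l Y"
    using s lb \<open>Y \<subseteq> V\<close> by (intro mult_left_le_one_le sum_nonneg) auto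
  finally show ?thesis using 1 2 l' by (intro exI[of _ l']) auto
qed

section \<open>The invariant of the rearrangement and one step of it\<close>

text \<open>Subtracting the relation from \<open>sum v W\<close> leaves coefficients 1 - l on
  \<open>W\<close> and -l on \<open>Y\<close>; the triangle inequality adds up their absolute
  values.\<close>

lemma norm_sum_le_weights:
  fixes v :: "'i \<Rightarrow> 'a::real_normed_vector"
  assumes rel: "weighted_relation v (W \<union> Y) l" and fin: "finite W" "finite Y" and dis: "W \<inter> Y = {}"
    and nv: "\<And>i. norm (v i) \<le> 1"
  shows "norm (sum v W) \<le> real (card W) - sum l (W \<union> Y) + 2 * sum l Y"
proof -
  have lb: "\<forall>i\<in>W \<union> Y. 0 \<le> l i \<and> l i \<le> 1" and z: "(\<Sum>i\<in>W \<union> Y. l i *\<^sub>R v i) = 0"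
    using rel by (auto simp: weighted_relation_def)
  have "sum v W = (\<Sum>i\<in>W. (1 - l i) *\<^sub>R v i) - (\<Sum>i\<in>Y. l i *\<^sub>R v i)"
    using z fin dis by (simp add: sum.union_disjoint scaleR_diff_left sum_subtractf add_eq_0_iff)
  also have "norm \<dots> \<le> norm (\<Sum>i\<in>W. (1 - l i) *\<^sub>R v i) + norm (\<Sum>i\<in>Y. l i *\<^sub>R v i)"
    by (rule norm_triangle_ineq4)
  also have "norm (\<Sum>i\<in>W. (1 - l i) *\<^sub>R v i) \<le> (\<Sum>i\<in>W. 1 - l i)"
    using lb nv by (intro sum_norm_le) (auto intro!: mult_left_le)
  also have "norm (\<Sum>i\<in>Y. l i *\<^sub>R v i) \<le> (\<Sum>i\<in>Y. l i)"
    using lb nv by (intro sum_norm_le) (auto intro!: mult_left_le)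
  finally show ?thesis using fin dis by (simp add: sum.union_disjoint sum_subtractf)
qed

text \<open>The rearrangement is built from its end: vectors are moved out of \<open>W\<close> one at a time.  A vector
  that is moved out may keep a small weight in the relation; such vectors form \<open>Y\<close>.  If the weight
  of \<open>W \<union> Y\<close> is at least \<open>card W + 1 - (d - 1 / d)\<close>, as it is right after a move, then the
  weight bound on \<open>Y\<close> and \<open>norm_sum_le_weights\<close> give \<open>norm (sum v W) \<le> d - 1 + 1 / d\<close>.\<close>

definition steinitz_state :: "('i \<Rightarrow> 'a::euclidean_space) \<Rightarrow> 'i set \<Rightarrow> 'i set \<Rightarrow> bool" where
  "steinitz_state v W Y \<longleftrightarrow> finite W \<and> finite Y \<and> W \<inter> Y = {} \<and> card Y \<le> 2 \<and>
     (\<exists>l. weighted_relation v (W \<union> Y) l \<and> sum l Y \<le> 1 / DIM('a) \<and>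
          real (card W) - (DIM('a) - 1 / DIM('a)) \<le> sum l (W \<union> Y))"

lemma exists_ge_average:
  fixes f :: "'i \<Rightarrow> real"
  assumes "finite G" "0 < sum f G" "real (card G) \<le> n"
  shows "\<exists>x\<in>G. sum f G / n \<le> f x"
proof (rule ccontr)
  assume H: "\<not> (\<exists>x\<in>G. sum f G / n \<le> f x)"
  have ne: "G \<noteq> {}" using assms by auto
  then have "0 < card G" using assms by (simp add: card_gt_0_iff)
  then have n: "0 < n" using assms by linarith
  have "sum f G < (\<Sum>x\<in>G. sum f G / n)"
    using H ne assms by (intro sum_strict_mono) (auto simp: not_le)
  also have "\<dots> = real (card G) / n * sum f G" by simp
  also have "\<dots> \<le> 1 * sum f G" using assms n by (intro mult_right_mono) auto
  finally show False by simp
qed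

text \<open>Here \<open>d\<close> is the dimension, \<open>L\<close> and \<open>q\<close> are the
  weight and the cardinality of \<open>Y\<close>, and \<open>x\<close> is the weight of the vector
  to be moved to \<open>Y\<close>. The hypothesis on \<open>x\<close> comes from averaging 1 -
  weight over the fractional vectors of \<open>W\<close>. It gives x \<le> 1/d if \<open>Y\<close>
  is empty, and x \<le> 1/d^2 - L/d if \<open>Y\<close> has one element.\<close>

lemma weight_increment_bound:
  fixes d L x :: real
  assumes d: "d \<ge> 2" and L: "0 \<le> L" "L \<le> 1 / d" and q: "q = 0 \<and> L = 0 \<or> q = 1"
    and x: "(d - 1 / d + L) / (d + 1 - q) \<le> 1 - x"
  shows "L + x \<le> 1 / d"
  using q
proof
  assume *: "q = 0 \<and> L = 0"
  have "d - 1 / d = (1 - 1 / d) * (d + 1)" using d by (simp add: field_simps)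
  then have "(d - 1 / d) / (d + 1) = 1 - 1 / d" using d by simp
  then show ?thesis using x * by simp
next
  assume *: "q = 1"
  have "(d - 1 / d + L) / d = 1 - 1 / d\<^sup>2 + L / d"
    using d by (simp add: field_simps power2_eq_square)
  then have "L + x \<le> L * (1 - 1 / d) + 1 / d\<^sup>2" using x * by (simp add: algebra_simps)
  also have "\<dots> \<le> (1 / d) * (1 - 1 / d) + 1 / d\<^sup>2"
    using L d by (intro add_right_mono mult_right_mono) auto
  also have "\<dots> = 1 / d" using d by (simp add: field_simps power2_eq_square)
  finally show ?thesis .
qed

text \<open>Decrease the total weight to \<open>card W - (d - 1 / d)\<close> and pass to a relation with at most d + 1
  fractional weights that does not increase the weight of \<open>Y\<close>.  A vector of \<open>W\<close> of weight 0
  can be removed, and one of \<open>Y\<close> can be forgotten.  If all weights are positive, then \<open>card Y \<le> 1\<close>,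
  and averaging finds a vector of \<open>W\<close> that is light enough to be moved to \<open>Y\<close>.\<close>

lemma steinitz_step:
  fixes v :: "'i \<Rightarrow> 'a::euclidean_space"
  assumes "steinitz_state v W Y" "DIM('a) \<le> card W" and dim: "2 \<le> DIM('a)"
    and nv: "\<And>i. norm (v i) \<le> 1"
  shows "\<exists>x\<in>W. \<exists>Y'. steinitz_state v (W - {x}) Y' \<and>
           norm (sum v (W - {x})) \<le> real DIM('a) - 1 + 1 / DIM('a)"
  using assms(1)
proof (induction "card Y" arbitrary: Y rule: less_induct)
  case less
  define d where "d = real DIM('a)"
  have d: "d \<ge> 2" using dim by (simp add: d_def)
  have d1: "0 < 1 / d" "1 / d \<le> 1 / 2" using d by (auto simp: field_simps)
  from less.prems obtain l where fin: "finite W" "finite Y" and dis: "W \<inter> Y = {}" and Y2: "card Y \<le> 2"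
    and l: "weighted_relation v (W \<union> Y) l" "sum l Y \<le> 1 / d" "real (card W) - (d - 1 / d) \<le> sum l (W \<union> Y)"
    unfolding steinitz_state_def d_def by blast
  define T where "T = real (card W) - (d - 1 / d)"
  have "d \<le> real (card W)" using assms by (simp add: d_def)
  then have T: "0 < T" using d1 unfolding T_def by linarith
  obtain k where k: "weighted_relation v (W \<union> Y) k" "sum k (W \<union> Y) = T" "sum k Y \<le> 1 / d"
      "card {i\<in>W \<union> Y. 0 < k i \<and> k i < 1} \<le> DIM('a) + 1"
    using weighted_relation_few_fractional[OF l(1) _ _ T, of Y] l fin unfolding T_def by fastforce
  have kb: "\<forall>i\<in>W \<union> Y. 0 \<le> k i \<and> k i \<le> 1" using k(1) by (simp add: weighted_relation_def)
  \<comment> \<open>Both ways of removing \<open>x\<close> from \<open>W\<close> end here. The total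
    weight stays \<open>T\<close>, which is card (W - {x}) + 1 - (d - 1/d), so the norm is at most d
    - 1/d - 1 + 2/d = d - 1 + 1/d.\<close>
  have move: ?case if x: "x \<in> W" and Y': "finite Y'" "Y' \<inter> (W - {x}) = {}" "card Y' \<le> 2"
    and rel: "weighted_relation v (W - {x} \<union> Y') k" and s: "sum k (W - {x} \<union> Y') = T" and L: "sum k Y' \<le> 1 / d"
    for x Y'
  proof -
    have c: "real (card (W - {x})) = real (card W) - 1"
    proof -
      have "card W > 0" using x fin by (auto simp: card_gt_0_iff)
      then show ?thesis using x fin by (simp add: of_nat_diff)
    qed
    have "steinitz_state v (W - {x}) Y'"
      unfolding steinitz_state_def using fin Y' rel s L c
      by (auto intro!: exI[of _ k] simp: T_def d_def)
    moreover have "norm (sum v (W - {x})) \<le> d - 1 + 1 / d"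
    proof -
      have "norm (sum v (W - {x})) \<le> real (card (W - {x})) - T + 2 * sum k Y'"
        using norm_sum_le_weights[OF rel _ Y'(1) _ nv] fin Y'(2) s by (simp add: Int_commute)
      then show ?thesis using L c unfolding T_def by linarith
    qed
    ultimately show ?thesis using x unfolding d_def by blast
  qed
  show ?case
  proof (cases "\<exists>x\<in>W. k x = 0")
    case True
    then obtain x where x: "x \<in> W" "k x = 0" by auto
    then have sub: "W - {x} \<union> Y \<subseteq> W \<union> Y" "\<forall>i\<in>W \<union> Y - (W - {x} \<union> Y). k i = 0" by auto
    show ?thesis
      using move[of x Y] x fin dis Y2 k weighted_relation_subset[OF k(1) sub(1) _ sub(2)] by auto
  next
    case noW: False
    show ?thesis
    proof (cases "\<exists>y\<in>Y. k y = 0")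
      case True
      then obtain y where y: "y \<in> Y" "k y = 0" by auto
      then have sub: "W \<union> (Y - {y}) \<subseteq> W \<union> Y" "\<forall>i\<in>W \<union> Y - (W \<union> (Y - {y})). k i = 0" by auto
      have lt: "card (Y - {y}) < card Y" using y fin by (intro psubset_card_mono) auto
      have "sum k (Y - {y}) = sum k Y" using y fin by (simp add: sum_diff1)
      then have "steinitz_state v W (Y - {y})"
        unfolding steinitz_state_def
        using fin dis lt Y2 k weighted_relation_subset[OF k(1) sub(1) _ sub(2)]
        by (auto intro!: exI[of _ k] simp: T_def d_def)
      then show ?thesis using less.hyps[OF lt] by blast
    next
      case noY: False
      have pos: "0 < k i" if "i \<in> W \<union> Y" for i using kb noW noY that by force
      define L where "L = sum k Y"
      have L0: "0 \<le> L" unfolding L_def using kb by (intro sum_nonneg) auto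
      \<comment> \<open>The weight of \<open>Y\<close> is at most 1/d \<le> 1/2, so every vector of
        \<open>Y\<close> is fractional and leaves one place fewer for fractional vectors of
        \<open>W\<close>.\<close>
      have Y1: "k y < 1" if "y \<in> Y" for y
      proof -
        have "k y \<le> sum k Y" using that fin kb by (intro member_le_sum) auto
        then show ?thesis using k d1 by linarith
      qed
      define F where "F = {i\<in>W \<union> Y. 0 < k i \<and> k i < 1}"
      define G where "G = F - Y"
      have YF: "Y \<subseteq> F" and finF: "finite F" and GW: "G \<subseteq> W" using Y1 pos fin by (auto simp: F_def G_def)
      have G: "finite G" "card G = card F - card Y"
        using finF YF fin by (auto simp: G_def card_Diff_subset)
      have cG: "real (card G) \<le> d + 1 - real (card Y)"
        using k(4) G card_mono[OF finF YF] unfolding F_def[symmetric] d_def by linarith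
      have "(\<Sum>i\<in>W \<union> Y. 1 - k i) = (\<Sum>i\<in>F. 1 - k i)"
        using fin kb pos by (intro sum.mono_neutral_right) (force simp: F_def)+
      also have "\<dots> = (\<Sum>i\<in>G. 1 - k i) + (\<Sum>i\<in>Y. 1 - k i)"
        unfolding G_def using finF YF by (rule sum.subset_diff[rotated])
      finally have sG: "(\<Sum>i\<in>G. 1 - k i) = d - 1 / d + L"
        using fin dis k(2) by (simp add: sum_subtractf card_Un_disjoint T_def L_def)
      \<comment> \<open>Each summand is at most 1, so d - 1/d + L \<le> card G \<le> d + 1 - card Y,
        which forces card Y \<le> 1 + 1/d < 2.\<close>
      have "(\<Sum>i\<in>G. 1 - k i) \<le> (\<Sum>i\<in>G. 1)"
        using pos GW by (intro sum_mono) (force simp: less_imp_le)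
      then have "real (card Y) < 2" using sG cG d1 L0 by (simp only: sum_constant mult_1_right)
      then have q: "real (card Y) = 0 \<and> L = 0 \<or> real (card Y) = 1" and q1: "card Y < 2"
        using fin by (auto simp: L_def less_2_cases_iff)
      have "0 < (\<Sum>i\<in>G. 1 - k i)" unfolding sG using d d1 L0 by linarith
      then obtain x where x: "x \<in> G" "(d - 1 / d + L) / (d + 1 - real (card Y)) \<le> 1 - k x"
        using exists_ge_average[OF G(1) _ cG, of "\<lambda>i. 1 - k i"] sG by auto
      have "x \<in> W" "x \<notin> Y" using x GW by (auto simp: G_def)
      have "L + k x \<le> 1 / d"
        using weight_increment_bound[OF d L0 _ q x(2)] k(3) by (simp add: L_def)
      moreover have "W - {x} \<union> insert x Y = W \<union> Y" using \<open>x \<in> W\<close> by auto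
      ultimately show ?thesis
        using move[of x "insert x Y"] \<open>x \<in> W\<close> \<open>x \<notin> Y\<close> fin dis k q1
        by (auto simp: L_def add.commute)
    qed
  qed
qed

section \<open>Orderings with bounded prefix sums\<close>

lemma norm_sum_list_le_length:
  fixes v :: "'i \<Rightarrow> 'a::real_normed_vector"
  assumes "\<And>i. norm (v i) \<le> 1"
  shows "norm (\<Sum>i\<leftarrow>xs. v i) \<le> length xs"
proof (induction xs)
  case (Cons a xs)
  have "norm (v a + (\<Sum>i\<leftarrow>xs. v i)) \<le> norm (v a) + norm (\<Sum>i\<leftarrow>xs. v i)"
    by (rule norm_triangle_ineq)
  then show ?case using Cons assms[of a] by simp
qed simp

text \<open>Each removed vector is put at the end of the order of the remaining ones. Once fewer
  than d vectors remain, any order works, since every prefix has norm at most d - 1.\<close>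

lemma steinitz_order_from_state:
  fixes v :: "'i \<Rightarrow> 'a::euclidean_space"
  assumes "steinitz_state v W Y" and "norm (sum v W) \<le> real DIM('a) - 1 + 1 / DIM('a)"
    and dim: "2 \<le> DIM('a)" and nv: "\<And>i. norm (v i) \<le> 1"
  shows "\<exists>xs. distinct xs \<and> set xs = W \<and>
           (\<forall>k. norm (\<Sum>i\<leftarrow>take k xs. v i) \<le> real DIM('a) - 1 + 1 / DIM('a))"
  using assms(1,2)
proof (induction "card W" arbitrary: W Y rule: less_induct)
  case less
  have fin: "finite W" using less.prems by (simp add: steinitz_state_def)
  show ?case
  proof (cases "DIM('a) \<le> card W")
    case True
    obtain x Y' where x: "x \<in> W" "steinitz_state v (W - {x}) Y'"
        "norm (sum v (W - {x})) \<le> real DIM('a) - 1 + 1 / DIM('a)"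
      using steinitz_step[OF less.prems(1) True dim nv] by blast
    have "card (W - {x}) < card W" using x fin by (intro psubset_card_mono) auto
    from less.hyps[OF this x(2,3)] obtain xs where xs: "distinct xs" "set xs = W - {x}"
        "\<And>k. norm (\<Sum>i\<leftarrow>take k xs. v i) \<le> real DIM('a) - 1 + 1 / DIM('a)" by blast
    have tot: "(\<Sum>i\<leftarrow>xs @ [x]. v i) = sum v W"
      using xs x fin by (simp add: sum_list_distinct_conv_sum_set sum_diff1)
    have "norm (\<Sum>i\<leftarrow>take k (xs @ [x]). v i) \<le> real DIM('a) - 1 + 1 / DIM('a)" for k
    proof (cases "k \<le> length xs")
      case True
      then show ?thesis using xs(3)[of k] by simp
    next
      case False
      then have "take k (xs @ [x]) = xs @ [x]" by simp
      then show ?thesis using tot less.prems(2) by metis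
    qed
    then show ?thesis using xs x by (intro exI[of _ "xs @ [x]"]) auto
  next
    case False
    obtain xs where xs: "set xs = W" "distinct xs" using finite_distinct_list[OF fin] by blast
    have len: "real (length xs) \<le> real DIM('a) - 1" using False xs distinct_card[of xs] by simp
    have "norm (\<Sum>i\<leftarrow>take k xs. v i) \<le> real DIM('a) - 1 + 1 / DIM('a)" for k
    proof -
      have "norm (\<Sum>i\<leftarrow>take k xs. v i) \<le> length (take k xs)"
        by (rule norm_sum_list_le_length) (rule nv)
      also have "\<dots> \<le> real DIM('a) - 1" using len by simp
      finally show ?thesis by (simp add: add_increasing2)
    qed
    then show ?thesis using xs by blast
  qed
qed

theorem steinitz_banaszczyk:
  fixes v :: "'i \<Rightarrow> 'a::euclidean_space"
  assumes fin: "finite I" and sum0: "sum v I = 0" and r: "0 < r" and nv: "\<And>i. i \<in> I \<Longrightarrow> norm (v i) \<le> r"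
    and dim: "2 \<le> DIM('a)"
  shows "\<exists>xs. distinct xs \<and> set xs = I \<and>
           (\<forall>k. norm (\<Sum>i\<leftarrow>take k xs. v i) \<le> (real DIM('a) - 1 + 1 / DIM('a)) * r)"
proof -
  \<comment> \<open>The value 0 outside \<open>I\<close> gives the norm bound for all indices, as
    the step lemmas assume.\<close>
  define u where "u i = (if i \<in> I then v i /\<^sub>R r else 0)" for i
  have nu: "norm (u i) \<le> 1" for i using nv r by (auto simp: u_def field_simps)
  have su: "sum u I = 0"
    using sum0 by (simp add: u_def flip: scaleR_sum_right)
  \<comment> \<open>The initial state has all weights 1 and \<open>Y\<close> empty; this inequality
    says that the required total weight is at most \<open>card I\<close>.\<close>
  have "1 / real DIM('a) \<le> DIM('a)" using dim by (simp add: field_simps flip: of_nat_mult)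
  then have st: "steinitz_state u I {}"
    using fin su by (auto simp: steinitz_state_def weighted_relation_def intro!: exI[of _ "\<lambda>_. 1"])
  have tot: "norm (sum u I) \<le> real DIM('a) - 1 + 1 / DIM('a)" using su dim by simp
  obtain xs where xs: "distinct xs" "set xs = I"
      "\<And>k. norm (\<Sum>i\<leftarrow>take k xs. u i) \<le> real DIM('a) - 1 + 1 / DIM('a)"
    using steinitz_order_from_state[OF st tot dim nu] by blast
  have "norm (\<Sum>i\<leftarrow>take k xs. v i) \<le> (real DIM('a) - 1 + 1 / DIM('a)) * r" for k
  proof -
    have "(\<Sum>i\<leftarrow>take k xs. v i) = (\<Sum>i\<leftarrow>take k xs. r *\<^sub>R u i)"
      using xs(2) r by (intro arg_cong[of _ _ sum_list] map_cong) (auto simp: u_def dest: in_set_takeD)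
    also have "\<dots> = r *\<^sub>R (\<Sum>i\<leftarrow>take k xs. u i)"
      by (induction xs arbitrary: k) (auto simp: take_Cons' scaleR_add_right)
    finally show ?thesis using xs(3)[of k] r by (simp add: mult.commute)
  qed
  then show ?thesis using xs by blast
qed

text \<open>The rearrangement is applied to the positions in a list, so that equal terms have
  distinct indices.\<close>

lemma steinitz_mset:
  fixes f :: "'b \<Rightarrow> 'a::euclidean_space"
  assumes "(\<Sum>x\<in>#S. f x) = 0" and "0 < r" and "\<And>x. x \<in># S \<Longrightarrow> norm (f x) \<le> r" and "2 \<le> DIM('a)"
  shows "\<exists>ys. mset ys = S \<and>
           (\<forall>k. norm (\<Sum>x\<leftarrow>take k ys. f x) \<le> (real DIM('a) - 1 + 1 / DIM('a)) * r)"
proof -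
  obtain zs where zs: "mset zs = S" using ex_mset by blast
  let ?I = "{..<length zs}"
  have "(\<Sum>i\<in>?I. f (zs ! i)) = (\<Sum>x\<leftarrow>zs. f x)"
    by (simp add: sum_list_sum_nth atLeast0LessThan)
  also have "\<dots> = (\<Sum>x\<in>#S. f x)" by (simp flip: zs sum_mset_sum_list mset_map)
  finally have "(\<Sum>i\<in>?I. f (zs ! i)) = 0" using assms(1) by simp
  moreover have "norm (f (zs ! i)) \<le> r" if "i \<in> ?I" for i
    using that assms(3) by (simp flip: zs)
  ultimately obtain xs where xs: "distinct xs" "set xs = ?I"
      "\<And>k. norm (\<Sum>i\<leftarrow>take k xs. f (zs ! i)) \<le> (real DIM('a) - 1 + 1 / DIM('a)) * r"
    using steinitz_banaszczyk[of ?I "\<lambda>i. f (zs ! i)" r] assms by auto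
  have "mset xs = mset [0..<length zs]"
    using xs by (subst set_eq_iff_mset_eq_distinct[symmetric]) auto
  then have "mset (map ((!) zs) xs) = mset (map ((!) zs) [0..<length zs])" by (simp only: mset_map)
  then have "mset (map ((!) zs) xs) = S" by (simp only: map_nth zs)
  then show ?thesis using xs(3)
    by (intro exI[of _ "map ((!) zs) xs"]) (simp add: take_map o_def)
qed

subsection \<open>Prefix sums and lattice points\<close>

text \<open>Two equal prefix sums enclose a nonempty block with sum 0. The range contains the empty
  prefix but not the full list, so the block is proper and there is one prefix for each
  term.\<close>

lemma minimal_zero_sum_inj_prefix_sums:
  assumes "minimal_zero_sum X (mset ys)"
  shows "inj_on (\<lambda>k. sum_list (take k ys)) {..<length ys}"
proof -
  have False if jk: "j < k" "k < length ys" and eq: "sum_list (take j ys) = sum_list (take k ys)" for j k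
  proof -
    define ws where "ws = drop j (take k ys)"
    have split: "take k ys = take j ys @ ws"
      using append_take_drop_id[of j "take k ys"] jk by (simp add: ws_def min.absorb1)
    have "mset ws \<subseteq># mset (take k ys)" by (simp add: split)
    also have "\<dots> \<subseteq># mset ys" by (metis append_take_drop_id mset_append mset_subset_eq_add_left)
    finally have sub: "mset ws \<subseteq># mset ys" .
    have len: "length ws = k - j" using jk by (simp add: ws_def)
    then have "mset ws \<noteq> mset ys" using jk by (auto dest: mset_eq_length)
    then have "mset ws \<subset># mset ys" using sub by (simp add: subset_mset.less_le)
    moreover have "mset ws \<noteq> {#}" using len jk by auto
    moreover have "\<Sum>\<^sub># (mset ws) = 0" using eq by (simp add: split sum_mset_sum_list)
    ultimately show False using assms by (auto simp: minimal_zero_sum_def)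
  qed
  then show ?thesis by (intro linorder_inj_onI') (auto dest: sym)
qed

section \<open>Counting lattice points in a ball\<close>

text \<open>The norm of nested pairs of reals is Euclidean, so \<open>ball3\<close> corresponds to
  the lattice points of a ball in a Euclidean space of dimension 3.\<close>

definition real_vec :: "int \<times> int \<times> int \<Rightarrow> real \<times> real \<times> real" where
  "real_vec = (\<lambda>(a, b, c). (of_int a, of_int b, of_int c))"

lemma real_vec_add: "real_vec (u + w) = real_vec u + real_vec w"
  and real_vec_zero: "real_vec 0 = 0"
  by (auto simp: real_vec_def zero_prod_def split: prod.splits)

lemma real_vec_sum_list: "real_vec (sum_list xs) = (\<Sum>x\<leftarrow>xs. real_vec x)"
  by (induction xs) (auto simp: real_vec_zero real_vec_add)

lemma norm_real_vec_le_iff: "norm (real_vec u) \<le> real m \<longleftrightarrow> u \<in> ball3 m"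
proof (cases u)
  case (fields a b c)
  have "norm (real_vec u) \<le> real m \<longleftrightarrow> real_of_int (a\<^sup>2 + b\<^sup>2 + c\<^sup>2) \<le> real_of_int ((int m)\<^sup>2)"
    by (simp add: fields real_vec_def norm_Pair real_sqrt_le_iff' add.assoc)
  then show ?thesis unfolding of_int_le_iff by (simp add: fields ball3_def)
qed

text \<open>Half-open unit cubes at the points are disjoint, because taking floors recovers the
  corner. They lie in a ball of radius \<open>R + 3\<close>, as the coordinate differences add up to
  less than 3; the enlargement is of lower order in the volume.\<close>

lemma card_lattice_points_le:
  assumes fin: "finite A" and R: "0 \<le> R" and A: "\<And>u. u \<in> A \<Longrightarrow> norm (real_vec u) \<le> R"
  shows "real (card A) \<le> 4 / 3 * pi * (R + 3) ^ 3"
proof -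
  define Q :: "int \<times> int \<times> int \<Rightarrow> (real \<times> real \<times> real) set" where
    "Q = (\<lambda>(a, b, c). {of_int a..<of_int a + 1} \<times> {of_int b..<of_int b + 1} \<times> {of_int c..<of_int c + 1})"
  have Q_sets: "Q u \<in> sets lborel" for u
    by (cases u) (auto simp: Q_def intro!: borel_Times)
  have Q_vol: "emeasure lborel (Q u) = 1" for u
  proof (cases u)
    case (fields a b c)
    have *: "emeasure lborel (B \<times> C) = emeasure lborel B * emeasure lborel C"
      if "B \<in> sets lborel" "C \<in> sets lborel" for B :: "real set" and C :: "'c::euclidean_space set"
      using that by (subst lborel_prod[symmetric]) (rule lborel.emeasure_pair_measure_Times)
    show ?thesis by (simp add: fields Q_def * borel_Times)
  qed
  have "disjoint_family_on Q A"
  proof (unfold disjoint_family_on_def, intro ballI impI)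
    have floors: "u = (\<lfloor>fst p\<rfloor>, \<lfloor>fst (snd p)\<rfloor>, \<lfloor>snd (snd p)\<rfloor>)" if "p \<in> Q u" for u p
      using that by (cases u) (auto simp: Q_def floor_unique)
    show "Q u \<inter> Q w = {}" if "u \<noteq> w" for u w using floors that by blast
  qed
  then have "(\<Sum>u\<in>A. emeasure lborel (Q u)) = emeasure lborel (\<Union>u\<in>A. Q u)"
    using Q_sets fin by (intro sum_emeasure) auto
  also have "\<dots> \<le> emeasure lborel (ball (0 :: real \<times> real \<times> real) (R + 3))"
  proof (intro emeasure_mono subsetI)
    fix p assume "p \<in> (\<Union>u\<in>A. Q u)"
    then obtain a b c where u: "(a, b, c) \<in> A" "p \<in> Q (a, b, c)" by force
    obtain x y z where p: "p = (x, y, z)" by (cases p)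
    have "norm (p - real_vec (a, b, c)) \<le> \<bar>x - a\<bar> + (\<bar>y - b\<bar> + \<bar>z - c\<bar>)"
      using norm_Pair_le[of "x - a" "(y - b, z - c)"] norm_Pair_le[of "y - b" "z - c"]
      by (simp add: p real_vec_def)
    also have "\<dots> < 3" using u by (auto simp: p Q_def)
    finally have "norm (p - real_vec (a, b, c)) < 3" .
    moreover have "norm p \<le> norm (p - real_vec (a, b, c)) + norm (real_vec (a, b, c))"
      by (metis diff_add_cancel norm_triangle_ineq)
    ultimately show "p \<in> ball 0 (R + 3)" using A[OF u(1)] by simp
  qed auto
  also have "\<dots> = ennreal (4 / 3 * pi * (R + 3) ^ 3)"
    using R by (simp add: emeasure_ball unit_ball_vol_3 power3_eq_cube)
  finally have "ennreal (real (card A)) \<le> ennreal (4 / 3 * pi * (R + 3) ^ 3)"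
    by (simp add: Q_vol ennreal_of_nat_eq_real_of_nat)
  then show ?thesis using R by (subst (asm) ennreal_le_iff) auto
qed

text \<open>The factor 7/3 is d - 1 + 1/d for d = 3, and 4/3 * (7/3)^3 = 1372/81 gives the leading
  coefficient.\<close>

lemma minimal_zero_sum_ball3_size_le:
  assumes S: "minimal_zero_sum (ball3 m) S" and m: "0 < m"
  shows "real (size S) \<le> 4 / 3 * pi * (7 / 3 * real m + 3) ^ 3"
proof -
  have sumS: "(\<Sum>x\<in>#S. real_vec x) = 0"
  proof -
    obtain zs where zs: "mset zs = S" using ex_mset by blast
    then have "sum_list zs = 0" using S by (auto simp: minimal_zero_sum_def sum_mset_sum_list)
    then show ?thesis
      using real_vec_sum_list[of zs] by (simp add: real_vec_zero flip: zs sum_mset_sum_list mset_map)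
  qed
  have "norm (real_vec x) \<le> real m" if "x \<in># S" for x
    using that S by (auto simp: norm_real_vec_le_iff minimal_zero_sum_def)
  then obtain ys where ys: "mset ys = S" "\<And>k. norm (\<Sum>x\<leftarrow>take k ys. real_vec x) \<le> 7 / 3 * real m"
    using steinitz_mset[OF sumS, of "real m"] m by auto
  let ?P = "(\<lambda>k. sum_list (take k ys)) ` {..<length ys}"
  have "card ?P = size S"
    using minimal_zero_sum_inj_prefix_sums[of "ball3 m" ys] S ys(1) by (auto simp: card_image)
  moreover have "real (card ?P) \<le> 4 / 3 * pi * (7 / 3 * real m + 3) ^ 3"
    using ys(2) by (intro card_lattice_points_le) (auto simp: real_vec_sum_list)
  ultimately show ?thesis by simp
qed

subsection \<open>A long minimal zero-sum sequence\<close>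

lemma sum_mset_replicate_mset_int3:
  "\<Sum>\<^sub># (replicate_mset n (a, b, c)) = (int n * a, int n * b, int n * (c :: int))"
  by (induction n) (auto simp: algebra_simps zero_prod_def)

lemma subseteq_mset_add_split:
  assumes "T \<subseteq># A + B"
  shows "\<exists>T1 T2. T = T1 + T2 \<and> T1 \<subseteq># A \<and> T2 \<subseteq># B"
proof (intro exI conjI)
  show "T = T \<inter># A + (T - A)" by (rule multiset_eqI) simp
  show "T - A \<subseteq># B" using assms by (simp add: subset_eq_diff_conv add.commute)
qed simp

text \<open>The four vectors are t(1,1,1), t(1,-1,-1), t(-1,1,-1), t(-1,-1,1) with the unit vectors added to
  the first three.  This perturbation makes the last two coefficients of their relation
  consecutive integers, so that the coefficients are coprime for every t.\<close>

lemma tetrahedron_relations: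
  fixes t x1 x2 x3 x4 :: int
  assumes "x1 * (t + 1) + x2 * t - x3 * t - x4 * t = 0"
    and "x1 * t + x2 * (1 - t) + x3 * t - x4 * t = 0"
    and "x1 * t - x2 * t + x3 * (1 - t) + x4 * t = 0"
  shows "x1 = (x4 - x3) * (t * (2 * t - 1)\<^sup>2)" and "x2 = (x4 - x3) * (4 * t ^ 3 + t)"
    and "x3 = (x4 - x3) * (4 * t ^ 3 - t)" and "x4 = (x4 - x3) * (4 * t ^ 3 - t + 1)"
  using assms by algebra+

text \<open>The multiplicities are those of \<open>tetrahedron_relations\<close> with x4 - x3 = 1.
  They are computed over the integers, where subtraction is not truncated.\<close>

definition tetrahedron_seq :: "nat \<Rightarrow> (int \<times> int \<times> int) multiset" where
  "tetrahedron_seq t =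
     (let s = int t in
      replicate_mset (nat (s * (2 * s - 1)\<^sup>2)) (s + 1, s, s) + (replicate_mset (nat (4 * s ^ 3 + s)) (s, 1 - s, - s)
      + (replicate_mset (nat (4 * s ^ 3 - s)) (- s, s, 1 - s) + replicate_mset (nat (4 * s ^ 3 - s + 1)) (- s, - s, s))))"

text \<open>The multiplicities in a zero-sum subsequence are c = x4 - x3 times the full ones. As c
  is an integer and x4 lies between 0 and its full value, c is 0 or 1. The condition on
  \<open>m\<close> bounds the norms, since every coordinate is at most t + 1 in absolute
  value.\<close>

lemma minimal_zero_sum_tetrahedron_seq:
  assumes t: "1 \<le> t" and m: "3 * (t + 1)\<^sup>2 \<le> m\<^sup>2"
  shows "minimal_zero_sum (ball3 m) (tetrahedron_seq t)"
  unfolding minimal_zero_sum_def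
proof (intro conjI allI impI)
  define s where "s = int t"
  have s: "1 \<le> s" using t by (simp add: s_def)
  have m': "3 * (s + 1)\<^sup>2 \<le> (int m)\<^sup>2"
  proof -
    have "int (3 * (t + 1)\<^sup>2) \<le> int (m\<^sup>2)" using m by (simp only: of_nat_le_iff)
    then show ?thesis by (simp add: s_def add.commute)
  qed
  define a1 a2 a3 a4 where a: "a1 = s * (2 * s - 1)\<^sup>2" "a2 = 4 * s ^ 3 + s" "a3 = 4 * s ^ 3 - s" "a4 = 4 * s ^ 3 - s + 1"
  have "s \<le> s ^ 3" using s by (simp add: self_le_power)
  then have pos: "0 < a1" "0 < a2" "0 < a3" "0 < a4" using s by (auto simp: a)
  have seq: "tetrahedron_seq t = replicate_mset (nat a1) (s + 1, s, s) + (replicate_mset (nat a2) (s, 1 - s, - s)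
      + (replicate_mset (nat a3) (- s, s, 1 - s) + replicate_mset (nat a4) (- s, - s, s)))"
    by (simp add: tetrahedron_seq_def s_def Let_def a)
  have "set_mset (tetrahedron_seq t) \<subseteq> {(s + 1, s, s), (s, 1 - s, - s), (- s, s, 1 - s), (- s, - s, s)}"
    by (auto simp: seq)
  also have "\<dots> \<subseteq> ball3 m"
    using m' s by (auto simp: ball3_def power2_eq_square algebra_simps)
  finally show "set_mset (tetrahedron_seq t) \<subseteq> ball3 m" .
  show "\<Sum>\<^sub># (tetrahedron_seq t) = 0"
    using pos by (auto simp: seq sum_mset_replicate_mset_int3 zero_prod_def)
      (auto simp: a algebra_simps power2_eq_square power3_eq_cube)
  fix T assume T: "T \<subset># tetrahedron_seq t" "T \<noteq> {#}"
  then have "T \<subseteq># tetrahedron_seq t" by simp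
  then obtain x1 x2 x3 x4 where x: "x1 \<le> nat a1" "x2 \<le> nat a2" "x3 \<le> nat a3" "x4 \<le> nat a4"
    and T_eq: "T = replicate_mset x1 (s + 1, s, s) + (replicate_mset x2 (s, 1 - s, - s)
      + (replicate_mset x3 (- s, s, 1 - s) + replicate_mset x4 (- s, - s, s)))"
    unfolding seq by (metis subseteq_mset_add_split msubseteq_replicate_msetE)
  show "\<Sum>\<^sub># T \<noteq> 0"
  proof
    assume "\<Sum>\<^sub># T = 0"
    then have "int x1 * (s + 1) + int x2 * s - int x3 * s - int x4 * s = 0"
        "int x1 * s + int x2 * (1 - s) + int x3 * s - int x4 * s = 0"
        "int x1 * s - int x2 * s + int x3 * (1 - s) + int x4 * s = 0"
      by (auto simp: T_eq sum_mset_replicate_mset_int3 zero_prod_def algebra_simps)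
    note rel = tetrahedron_relations[OF this, folded a]
    define c where "c = int x4 - int x3"
    have "0 \<le> c * a4" "c * a4 \<le> 1 * a4" using rel(4) x(4) pos by (auto simp: c_def)
    then have "0 \<le> c" "c \<le> 1" using pos by (auto simp: zero_le_mult_iff mult_le_cancel_right)
    then consider "c = 0" | "c = 1" by linarith
    then show False
    proof cases
      case 1
      then show False using rel T by (simp add: T_eq c_def)
    next
      case 2
      then have "x1 = nat a1" "x2 = nat a2" "x3 = nat a3" "x4 = nat a4" using rel by (auto simp: c_def)
      then show False using T by (simp add: T_eq seq)
    qed
  qed
qed

lemma size_tetrahedron_seq:
  assumes "1 \<le> t"
  shows "real (size (tetrahedron_seq t)) = 16 * real t ^ 3 - 4 * real t ^ 2 + 1"
proof -
  define s where "s = int t"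
  have s: "1 \<le> s" using assms by (simp add: s_def)
  have "s \<le> s ^ 3" using s by (simp add: self_le_power)
  then have "int (size (tetrahedron_seq t)) = s * (2 * s - 1)\<^sup>2 + (4 * s ^ 3 + s) + (4 * s ^ 3 - s) + (4 * s ^ 3 - s + 1)"
    using s by (simp add: tetrahedron_seq_def Let_def flip: s_def)
  also have "\<dots> = 16 * s ^ 3 - 4 * s ^ 2 + 1" by (simp add: algebra_simps power2_eq_square power3_eq_cube)
  finally have "real_of_int (int (size (tetrahedron_seq t))) = real_of_int (16 * s ^ 3 - 4 * s ^ 2 + 1)" by simp
  then show ?thesis by (simp add: s_def)
qed

subsection \<open>Asymptotics\<close>

lemma davenport_ge:
  assumes "minimal_zero_sum X S"
  shows "ereal (real (size S)) \<le> ereal_of_enat (davenport X)"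
proof -
  have "enat (size S) \<le> davenport X" unfolding davenport_def using assms by (intro SUP_upper) auto
  then show ?thesis by (metis ereal_of_enat_le_iff ereal_of_enat_simps(1))
qed

lemma davenport_le:
  assumes "\<And>S. minimal_zero_sum X S \<Longrightarrow> real (size S) \<le> B"
  shows "ereal_of_enat (davenport X) \<le> ereal B"
proof -
  \<comment> \<open>The empty sequence has length 0, so the floor of \<open>B\<close> is a natural
    number.\<close>
  have B: "0 \<le> B" using assms[of "{#}"] by (simp add: minimal_zero_sum_def)
  have "davenport X \<le> enat (nat \<lfloor>B\<rfloor>)"
    unfolding davenport_def using assms by (intro SUP_least) (auto intro: le_nat_floor)
  then have "ereal_of_enat (davenport X) \<le> ereal (nat \<lfloor>B\<rfloor>)"
    by (metis ereal_of_enat_le_iff ereal_of_enat_simps(1))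
  also have "\<dots> \<le> ereal B" using B by simp
  finally show ?thesis .
qed

text \<open>Only a lower bound for the extended-real quotient is needed, and the limit is then taken
  among real sequences.\<close>

lemma asymp_le_of_tendsto:
  fixes f :: "nat \<Rightarrow> real"
  assumes "f \<longlonglongrightarrow> 1" and "\<forall>\<^sub>F m in sequentially. ereal (f m) \<le> v m / u m"
  shows "asymp_le u v"
proof -
  have "liminf (\<lambda>m. ereal (f m)) = 1"
    using assms(1) by (intro lim_imp_Liminf) (auto simp: one_ereal_def)
  then show ?thesis unfolding asymp_le_def using Liminf_mono[OF assms(2)] by simp
qed

lemma davenport_ball3_lower:
  "asymp_le (\<lambda>m. ereal (16 / (3 * sqrt 3) * real m ^ 3)) (\<lambda>m. ereal_of_enat (davenport (ball3 m)))"
proof -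
  \<comment> \<open>For large m this is the largest t with sqrt 3 * (t + 1) \<le> m, the condition
    for the tetrahedron sequence to lie in the ball.\<close>
  define t where "t m = nat \<lfloor>real m / sqrt 3\<rfloor> - 1" for m
  \<comment> \<open>A lower bound for the length 16 t^3 - 4 t^2 + 1, from t \<ge> x / sqrt 3 - 2 in
    the cubic term and t \<le> x in the quadratic one.\<close>
  define g where "g x = 16 * (x / sqrt 3 - 2) ^ 3 - 4 * x\<^sup>2" for x :: real
  define f where "f m = g (real m) / (16 / (3 * sqrt 3) * real m ^ 3)" for m
  show ?thesis
  proof (rule asymp_le_of_tendsto[of f])
    have "sqrt 3 ^ 3 = 3 * sqrt (3 :: real)" by (simp add: power3_eq_cube)
    then have "16 / (3 * sqrt 3) * x ^ 3 = 16 * (x / sqrt 3) ^ 3" for x :: real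
      by (simp only: power_divide times_divide_eq_left times_divide_eq_right)
    then have "f = (\<lambda>m. g (real m) / (16 * (real m / sqrt 3) ^ 3))"
      unfolding f_def by (simp only:)
    \<comment> \<open>With sqrt 3 generalized to a positive constant \<open>c\<close>, this is a
      limit of rational functions.\<close>
    moreover have "(\<lambda>m. (16 * (real m / c - 2) ^ 3 - 4 * (real m)\<^sup>2) / (16 * (real m / c) ^ 3)) \<longlonglongrightarrow> 1"
      if "0 < c" for c :: real
      using that by real_asymp
    ultimately show "f \<longlonglongrightarrow> 1" by (simp add: g_def)
    show "\<forall>\<^sub>F m in sequentially. ereal (f m) \<le> ereal_of_enat (davenport (ball3 m)) / ereal (16 / (3 * sqrt 3) * real m ^ 3)"
      \<comment> \<open>From m \<ge> 4 follows m / sqrt 3 \<ge> 2, so t \<ge> 1 and the cubed lower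
        bound for t is nonnegative.\<close>
      using eventually_ge_at_top[of 4]
    proof eventually_elim
      case (elim m)
      have "sqrt 3 \<le> 2" by (rule real_le_lsqrt) auto
      then have "2 \<le> real m / sqrt 3" using elim by (simp add: field_simps)
      then have fl: "2 \<le> \<lfloor>real m / sqrt 3\<rfloor>" by (simp add: le_floor_iff)
      have t_int: "int (t m) = \<lfloor>real m / sqrt 3\<rfloor> - 1" unfolding t_def using fl by linarith
      have t1: "1 \<le> t m" using t_int fl by linarith
      have t_eq: "real (t m) + 1 = of_int \<lfloor>real m / sqrt 3\<rfloor>"
        using arg_cong[OF t_int, of real_of_int] by simp
      have tu: "real (t m) + 1 \<le> real m / sqrt 3" and tl: "real m / sqrt 3 - 2 \<le> real (t m)"
        unfolding t_eq using t_eq by linarith+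
      have "3 * (real (t m) + 1)\<^sup>2 \<le> 3 * (real m / sqrt 3)\<^sup>2"
        using tu by (intro mult_left_mono power_mono) auto
      also have "\<dots> = (real m)\<^sup>2" by (simp add: power_divide)
      finally have "real (3 * (t m + 1)\<^sup>2) \<le> real (m\<^sup>2)" by (simp add: add.commute)
      then have "3 * (t m + 1)\<^sup>2 \<le> m\<^sup>2" by (simp only: of_nat_le_iff)
      from davenport_ge[OF minimal_zero_sum_tetrahedron_seq[OF t1 this]]
      have D: "ereal (16 * real (t m) ^ 3 - 4 * real (t m) ^ 2 + 1) \<le> ereal_of_enat (davenport (ball3 m))"
        using size_tetrahedron_seq[OF t1] by simp
      have "(real m / sqrt 3 - 2) ^ 3 \<le> real (t m) ^ 3"
        using tl \<open>2 \<le> real m / sqrt 3\<close> by (intro power_mono) auto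
      moreover have "real (t m) \<le> real m"
      proof -
        have "real m / sqrt 3 \<le> real m / 1" by (intro divide_left_mono) auto
        then show ?thesis using tu by simp
      qed
      then have "real (t m) ^ 2 \<le> real m ^ 2" by (intro power_mono) auto
      ultimately have "g (real m) \<le> 16 * real (t m) ^ 3 - 4 * real (t m) ^ 2 + 1"
        unfolding g_def by linarith
      then have "ereal (g (real m)) \<le> ereal_of_enat (davenport (ball3 m))"
        using D by (meson ereal_less_eq(3) order_trans)
      then have "ereal (g (real m)) / ereal (16 / (3 * sqrt 3) * real m ^ 3)
          \<le> ereal_of_enat (davenport (ball3 m)) / ereal (16 / (3 * sqrt 3) * real m ^ 3)"
        using elim by (intro ereal_divide_right_mono) auto
      then show ?case using elim by (simp add: f_def)
    qed
  qed
qed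

lemma davenport_ball3_upper:
  "asymp_le (\<lambda>m. ereal_of_enat (davenport (ball3 m))) (\<lambda>m. ereal (1372 / 81 * pi * real m ^ 3))"
proof -
  define N where "N m = 4 / 3 * pi * (7 / 3 * real m + 3) ^ 3" for m
  show ?thesis
  proof (rule asymp_le_of_tendsto)
    show "(\<lambda>m. 1372 / 81 * pi * real m ^ 3 / N m) \<longlonglongrightarrow> 1" unfolding N_def by real_asymp (simp add: power3_eq_cube)
    show "\<forall>\<^sub>F m in sequentially. ereal (1372 / 81 * pi * real m ^ 3 / N m)
        \<le> ereal (1372 / 81 * pi * real m ^ 3) / ereal_of_enat (davenport (ball3 m))"
      using eventually_gt_at_top[of 0]
    proof eventually_elim
      case (elim m)
      have N: "0 < N m" by (auto simp: N_def intro!: mult_pos_pos add_nonneg_pos)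
      \<comment> \<open>The one-term sequence 0 makes the Davenport constant positive, so that it
        can serve as a denominator.\<close>
      have "minimal_zero_sum (ball3 m) {#0#}"
        by (auto simp: minimal_zero_sum_def ball3_def zero_prod_def dest!: mset_subset_size)
      from davenport_ge[OF this] have D1: "0 < ereal_of_enat (davenport (ball3 m))"
        by (rule less_le_trans[rotated]) simp
      have "ereal_of_enat (davenport (ball3 m)) \<le> ereal (N m)"
        using minimal_zero_sum_ball3_size_le[OF _ elim] unfolding N_def by (rule davenport_le)
      then have "ereal (1372 / 81 * pi * real m ^ 3) / ereal (N m)
          \<le> ereal (1372 / 81 * pi * real m ^ 3) / ereal_of_enat (davenport (ball3 m))"
        using D1 N elim by (intro ereal_divide_left_mono) (auto simp: ereal_zero_less_0_iff)
      then show ?case using N by simp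
    qed
  qed
qed

theorem theorem6:
  shows "asymp_le (\<lambda>m. ereal (16 / (3 * sqrt 3) * real m ^ 3))
                  (\<lambda>m. ereal_of_enat (davenport (ball3 m)))
       \<and> asymp_le (\<lambda>m. ereal_of_enat (davenport (ball3 m)))
                  (\<lambda>m. ereal (1372 / 81 * pi * real m ^ 3))"
  using davenport_ball3_lower davenport_ball3_upper by blast

end
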